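(* Let $\varphi \in H^2$ and let $\mathbf{H}_\varphi$ be the Hankel operator with symbol $\varphi$. If $\mathbf{H}_\varphi$ is norm-attaining and has maximal norm, then $\mathbf{H}_\varphi$ has minimal norm.
   Context: $\mathbb{T}$ is the unit circle with normalized Lebesgue arc length measure; $L^p=L^p(\mathbb{T})$. For $1\le p\le\infty$, $H^p$ is the subspace of $L^p$ of functions whose Fourier coefficients vanish at negative indices. $\overline{H^2}$ is the space of complex conjugates of functions in $H^2$, and $\overline{P}$ is the orthogonal projection of $L^2$ onto $\overline{H^2}$. For $\varphi\in H^2$, the Hankel operator $\mathbf{H}_\varphi f := \overline{P}(\overline{\varphi} f)$ is a densely defined operator from $H^2$ to $\overline{H^2}$; one always has $\|\varphi\|_2\le \|\mathbf{H}_\varphi\|\le\|\varphi\|_\infty$. $\mathbf{H}_\varphi$ has minimal norm if $\|\mathbf{H}_\varphi\|=\|\varphi\|_2$, and maximal norm if $\|\mathbf{H}_\varphi\|=\|\varphi\|_\infty$. $\mathbf{H}_\varphi$ is norm-attaining if there is $g$ in the unit sphere of $H^2$ with $\|\mathbf{H}_\varphi\| = \|\mathbf{H}_\varphi g\|_2$. *)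

theory Defs
  imports "HOL-Analysis.Analysis" "HOL-Probability.Essential_Supremum"
begin

text \<open>The unit circle is parametrised by t in [0,1] (t corresponds to exp(2 pi i t));
  Lebesgue measure on [0,1] is normalized arc length measure.\<close>

definition T_measure :: "real measure" where
  "T_measure = restrict_space lborel {0..1}"

definition fourier_coeff :: "(real \<Rightarrow> complex) \<Rightarrow> int \<Rightarrow> complex" where
  "fourier_coeff f n = (LINT t|T_measure. f t * cis (- 2 * pi * real_of_int n * t))"

definition in_L2 :: "(real \<Rightarrow> complex) \<Rightarrow> bool" where
  "in_L2 f \<longleftrightarrow> f \<in> borel_measurable T_measure \<and> integrable T_measure (\<lambda>t. (cmod (f t))^2)"

definition L2_norm :: "(real \<Rightarrow> complex) \<Rightarrow> real" where
  "L2_norm f = sqrt (LINT t|T_measure. (cmod (f t))^2)"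

definition L2_inner :: "(real \<Rightarrow> complex) \<Rightarrow> (real \<Rightarrow> complex) \<Rightarrow> complex" where
  "L2_inner f g = (LINT t|T_measure. f t * cnj (g t))"

definition Linf_norm :: "(real \<Rightarrow> complex) \<Rightarrow> ereal" where
  "Linf_norm f = esssup T_measure (\<lambda>t. ereal (cmod (f t)))"

definition H2 :: "(real \<Rightarrow> complex) set" where
  "H2 = {f. in_L2 f \<and> (\<forall>n<0. fourier_coeff f n = 0)}"

definition conj_H2 :: "(real \<Rightarrow> complex) set" where
  "conj_H2 = {f. \<exists>g\<in>H2. \<forall>t. f t = cnj (g t)}"

definition is_conj_proj :: "(real \<Rightarrow> complex) \<Rightarrow> (real \<Rightarrow> complex) \<Rightarrow> bool" where
  "is_conj_proj h k \<longleftrightarrow> k \<in> conj_H2 \<and> (\<forall>u\<in>conj_H2. L2_inner (\<lambda>t. h t - k t) u = 0)"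

definition conjP :: "(real \<Rightarrow> complex) \<Rightarrow> (real \<Rightarrow> complex)" where
  "conjP h = (SOME k. is_conj_proj h k)"

text \<open>Hankel operator, defined on its natural (maximal) domain in H2.\<close>
definition hankel_dom :: "(real \<Rightarrow> complex) \<Rightarrow> (real \<Rightarrow> complex) set" where
  "hankel_dom \<phi> = {f \<in> H2. in_L2 (\<lambda>t. cnj (\<phi> t) * f t)}"

definition hankel :: "(real \<Rightarrow> complex) \<Rightarrow> (real \<Rightarrow> complex) \<Rightarrow> (real \<Rightarrow> complex)" where
  "hankel \<phi> f = conjP (\<lambda>t. cnj (\<phi> t) * f t)"

definition hankel_norm :: "(real \<Rightarrow> complex) \<Rightarrow> ereal" where
  "hankel_norm \<phi> = Sup ((\<lambda>f. ereal (L2_norm (hankel \<phi> f))) ` {f \<in> hankel_dom \<phi>. L2_norm f \<le> 1})"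

definition hankel_minimal_norm :: "(real \<Rightarrow> complex) \<Rightarrow> bool" where
  "hankel_minimal_norm \<phi> \<longleftrightarrow> hankel_norm \<phi> = ereal (L2_norm \<phi>)"

definition hankel_maximal_norm :: "(real \<Rightarrow> complex) \<Rightarrow> bool" where
  "hankel_maximal_norm \<phi> \<longleftrightarrow> hankel_norm \<phi> = Linf_norm \<phi>"

definition hankel_norm_attaining :: "(real \<Rightarrow> complex) \<Rightarrow> bool" where
  "hankel_norm_attaining \<phi> \<longleftrightarrow>
     (\<exists>g \<in> hankel_dom \<phi>. L2_norm g = 1 \<and> hankel_norm \<phi> = ereal (L2_norm (hankel \<phi> g)))"

end

theory Submission
  imports Defs "HOL-Computational_Algebra.Polynomial"
begin

text \<open>
  Let \<open>m\<close> be the norm of the operator, attained at \<open>g\<close>. Since \<open>|\<phi>| \<le> m\<close> almost everywhere,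
  \<open>m = \<parallel>conjP (cnj \<phi> g)\<parallel> \<le> \<parallel>cnj \<phi> g\<parallel> \<le> m\<close>, so \<open>(m\<^sup>2 - |\<phi>|\<^sup>2) |g|\<^sup>2 = 0\<close> almost everywhere. A nonzero
  function in \<open>H\<^sup>2\<close> cannot vanish on a set of positive measure (F. and M. Riesz), hence \<open>|\<phi>| = m\<close>
  almost everywhere and \<open>\<parallel>\<phi>\<parallel>\<^sub>2 = m\<close>.

  For the uniqueness theorem, let \<open>p\<close> be a polynomial in \<open>z\<close> and \<open>h = Re p\<close>, with mean \<open>Re (p 0)\<close>.
  Integrating \<open>g exp p\<close> gives \<open>|g\<^sub>0| exp (mean h) \<le> \<integral> |g| exp h\<close>, where \<open>g\<^sub>0\<close> is the mean of \<open>g\<close>; by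
  Stone--Weierstrass this holds, up to a constant, for every real continuous \<open>h\<close> on the circle. If
  \<open>g\<close> vanishes on a compact set \<open>K\<close> of positive measure, letting \<open>h\<close> decrease to \<open>N\<close> times the
  indicator of \<open>K\<close> and then \<open>N\<close> tend to infinity yields \<open>g\<^sub>0 = 0\<close>. Dividing by \<open>z\<close> repeatedly, all
  Fourier coefficients of \<open>g\<close> vanish.
\<close>

section \<open>Fourier coefficients and functions of analytic type\<close>

lemma space_T_measure [simp]: "space T_measure = {0..1}"
  by (simp add: T_measure_def space_restrict_space)

lemma sets_T_measure_iff: "A \<in> sets T_measure \<longleftrightarrow> A \<subseteq> {0..1} \<and> A \<in> sets borel"
  by (simp add: T_measure_def sets_restrict_space_iff)

lemma emeasure_T_measure: "A \<subseteq> {0..1} \<Longrightarrow> emeasure T_measure A = emeasure lborel A"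
  by (simp add: T_measure_def emeasure_restrict_space)

interpretation T: finite_measure T_measure
  by (rule finite_measureI) (simp add: emeasure_T_measure)

lemma measure_T_measure_space [simp]: "measure T_measure {0..1} = 1"
  by (simp add: measure_def emeasure_T_measure)

lemma continuous_measurable_T:
  "continuous_on UNIV f \<Longrightarrow> f \<in> borel_measurable T_measure"
  for f :: "real \<Rightarrow> 'a::topological_space"
  unfolding T_measure_def
  by (intro measurable_restrict_space1) (simp add: borel_measurable_continuous_onI)

text \<open>\<open>circ\<close> identifies the endpoints 0 and 1, so a set on the circle can be
  pulled back to the interval unambiguously only away from these two points.\<close>

lemma AE_T_measure_interior: "AE t in T_measure. 0 < t \<and> t < 1"
proof -
  have "{0, 1::real} \<in> null_sets T_measure"
    by (auto simp: null_sets_def sets_T_measure_iff emeasure_T_measure emeasure_lborel_countable)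
  then show ?thesis
    by (rule AE_I') auto
qed

lemma integrable_mult_bounded:
  fixes f g :: "'a \<Rightarrow> 'b::{banach, second_countable_topology, real_normed_algebra}"
  assumes "integrable M g" "f \<in> borel_measurable M" "\<And>t. norm (f t) \<le> B"
  shows "integrable M (\<lambda>t. g t * f t)"
proof (rule Bochner_Integration.integrable_bound)
  show "integrable M (\<lambda>t. B * norm (g t))"
    using assms(1) by simp
  show "(\<lambda>t. g t * f t) \<in> borel_measurable M"
    using assms(1,2) by (auto dest: borel_measurable_integrable)
  have "norm (g t * f t) \<le> B * norm (g t)" for t
    by (rule order_trans[OF norm_mult_ineq])
       (metis assms(3) mult.commute mult_right_mono norm_ge_zero)
  then show "AE t in M. norm (g t * f t) \<le> norm (B * norm (g t))"
    by (intro AE_I2) (metis abs_ge_self order_trans real_norm_def)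
qed

section \<open>The coordinate on the circle and shifts of Fourier coefficients\<close>

definition circ :: "real \<Rightarrow> complex" where
  "circ t = cis (2 * pi * t)"

lemma norm_circ [simp]: "norm (circ t) = 1"
  by (simp add: circ_def)

lemma continuous_on_circ [continuous_intros]: "continuous_on A circ"
  unfolding circ_def cis_conv_exp by (intro continuous_intros)

text \<open>The parameters differ by an integer; as one is interior and the other lies in the closed
  interval, this integer is strictly between -1 and 1.\<close>

lemma circ_eq_iff:
  assumes "0 < t" "t < 1" "0 \<le> s" "s \<le> 1"
  shows "circ s = circ t \<longleftrightarrow> s = t"
proof
  assume "circ s = circ t"
  then have "exp (\<i> * of_real (2 * pi * s)) = exp (\<i> * of_real (2 * pi * t))"
    by (simp add: circ_def cis_conv_exp)
  then obtain n :: int where n: "2 * pi * s = 2 * pi * t + 2 * pi * real_of_int n"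
    unfolding exp_eq by (auto simp: complex_eq_iff mult_ac)
  then have "2 * pi * s = 2 * pi * (t + real_of_int n)"
    by (simp add: algebra_simps)
  then have s: "s = t + real_of_int n"
    by simp
  with assms have "-1 < real_of_int n" "real_of_int n < 1"
    by linarith+
  then have "n = 0" by linarith
  with s show "s = t" by simp
qed simp

lemma integrable_mult_circ:
  fixes f :: "complex \<Rightarrow> complex"
  assumes "integrable T_measure g" "continuous_on (sphere 0 1) f"
  shows "integrable T_measure (\<lambda>t. g t * f (circ t))"
proof -
  have "compact (f ` sphere 0 1)"
    using assms(2) by (intro compact_continuous_image) auto
  then obtain B where B: "\<And>z. z \<in> sphere 0 1 \<Longrightarrow> norm (f z) \<le> B"
    unfolding compact_eq_bounded_closed bounded_iff by blast
  show ?thesis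
  proof (rule integrable_mult_bounded)
    show "(\<lambda>t. f (circ t)) \<in> borel_measurable T_measure"
      by (intro continuous_measurable_T continuous_on_compose2[OF assms(2)] continuous_intros) auto
    show "norm (f (circ t)) \<le> B" for t
      by (intro B) auto
  qed fact
qed

lemma fourier_coeff_0: "fourier_coeff g 0 = (LINT t|T_measure. g t)"
  by (simp add: fourier_coeff_def)

lemma fourier_coeff_mult_circ:
  "fourier_coeff (\<lambda>t. g t * circ t) n = fourier_coeff g (n - 1)"
  unfolding fourier_coeff_def circ_def
  by (simp add: mult.assoc cis_mult algebra_simps)

lemma fourier_coeff_mult_cnj_circ:
  "fourier_coeff (\<lambda>t. g t * cnj (circ t)) n = fourier_coeff g (n + 1)"
  unfolding fourier_coeff_def circ_def cis_cnj
  by (simp add: mult.assoc cis_mult algebra_simps)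

lemma fourier_coeff_cnj: "fourier_coeff (\<lambda>t. cnj (g t)) n = cnj (fourier_coeff g (- n))"
proof -
  have "cnj (g t) * cis (- 2 * pi * real_of_int n * t)
      = cnj (g t * cis (- 2 * pi * real_of_int (- n) * t))" for t
    by (simp add: cis_cnj)
  then show ?thesis
    unfolding fourier_coeff_def by (simp only: Bochner_Integration.integral_cnj)
qed

text \<open>This is membership in \<open>H^1\<close>: integrability suffices for pairing with
  continuous functions of \<open>circ t\<close>.\<close>

definition analytic_type :: "(real \<Rightarrow> complex) \<Rightarrow> bool" where
  "analytic_type g \<longleftrightarrow> integrable T_measure g \<and> (\<forall>n<0. fourier_coeff g n = 0)"

lemma analytic_type_mult_circ:
  "analytic_type g \<Longrightarrow> analytic_type (\<lambda>t. g t * circ t)"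
  unfolding analytic_type_def fourier_coeff_mult_circ
  using integrable_mult_circ[of g "\<lambda>z. z"] by (auto intro: continuous_intros)

section \<open>Integrals against polynomials and their exponentials\<close>

lemma continuous_on_poly_complex [continuous_intros]: "continuous_on A (poly p)" for p :: "complex poly"
  by (intro continuous_intros)

text \<open>Induction along Horner's scheme: the factor \<open>circ t\<close> in front of
  \<open>p\<close> is absorbed into \<open>g\<close>, which is why \<open>g\<close> is arbitrary.
  The new function is again of analytic type, and its mean is the coefficient of \<open>g\<close> at
  -1, which is 0.\<close>

lemma integral_mult_poly:
  assumes "analytic_type g"
  shows "(LINT t|T_measure. g t * poly p (circ t)) = poly p 0 * fourier_coeff g 0"
  using assms
proof (induction p arbitrary: g)
  case 0
  then show ?case by simp
next
  case (pCons a p)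
  have g: "integrable T_measure g"
    using pCons.prems by (simp add: analytic_type_def)
  have gc: "analytic_type (\<lambda>t. g t * circ t)"
    using pCons.prems by (rule analytic_type_mult_circ)
  then have i: "integrable T_measure (\<lambda>t. g t * circ t * poly p (circ t))"
    by (intro integrable_mult_circ[of "\<lambda>t. g t * circ t" "poly p"] continuous_on_poly_complex)
       (simp add: analytic_type_def)
  have "(LINT t|T_measure. g t * poly (pCons a p) (circ t)) =
    (LINT t|T_measure. g t * a + g t * circ t * poly p (circ t))"
    by (simp add: algebra_simps)
  also have "\<dots> = (LINT t|T_measure. g t * a) + (LINT t|T_measure. g t * circ t * poly p (circ t))"
    using g i by simp
  also have "\<dots> = a * fourier_coeff g 0 + poly p 0 * fourier_coeff g (- 1)"
    using pCons.IH[OF gc] by (simp add: fourier_coeff_0[of g] fourier_coeff_mult_circ)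
  also have "fourier_coeff g (- 1) = 0"
    using pCons.prems by (simp add: analytic_type_def)
  finally show ?case by simp
qed

text \<open>Supplies a majorant independent of \<open>n\<close> for exchanging the exponential
  series with an integral.\<close>

lemma norm_exp_partial_sum_le:
  "norm (\<Sum>k<n. w ^ k / fact k) \<le> exp (norm w)" for w :: complex
proof -
  have "norm (\<Sum>k<n. w ^ k / fact k) \<le> (\<Sum>k<n. norm w ^ k /\<^sub>R fact k)"
    by (rule order_trans[OF norm_sum]) (simp add: norm_divide norm_power divide_inverse_commute norm_mult norm_inverse)
  also have "\<dots> \<le> exp (norm w)"
    unfolding exp_def by (intro sum_le_suminf summable_exp_generic) auto
  finally show ?thesis .
qed

text \<open>Partial sums of the series for \<open>exp p\<close> are polynomials, so
  \<open>integral_mult_poly\<close> applies to each; on the circle they are bounded by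
  \<open>exp B\<close>, and dominated convergence gives the limit.\<close>

lemma integral_mult_exp_poly:
  assumes "analytic_type g"
  shows "(LINT t|T_measure. g t * exp (poly p (circ t))) = exp (poly p 0) * fourier_coeff g 0"
proof -
  define q where "q n = (\<Sum>k<n. smult (1 / fact k) (p ^ k))" for n
  have q: "poly (q n) z = (\<Sum>k<n. poly p z ^ k / fact k)" for n z
    by (simp add: q_def poly_sum poly_power)
  have lim: "(\<lambda>n. poly (q n) z) \<longlonglongrightarrow> exp (poly p z)" for z
    unfolding q using exp_converges[of "poly p z"]
    by (simp add: sums_def scaleR_conv_of_real field_simps)
  have "compact (poly p ` sphere 0 1)"
    by (intro compact_continuous_image continuous_intros) auto
  then obtain B where B: "\<And>z. z \<in> sphere 0 1 \<Longrightarrow> norm (poly p z) \<le> B"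
    unfolding compact_eq_bounded_closed bounded_iff by blast
  have g: "integrable T_measure g"
    using assms by (simp add: analytic_type_def)
  then have [measurable]: "g \<in> borel_measurable T_measure"
    by auto
  have [measurable]: "(\<lambda>t. poly r (circ t)) \<in> borel_measurable T_measure" for r
    by (intro continuous_measurable_T continuous_intros)
  have "(\<lambda>n. LINT t|T_measure. g t * poly (q n) (circ t)) \<longlonglongrightarrow>
        (LINT t|T_measure. g t * exp (poly p (circ t)))"
  proof (rule integral_dominated_convergence)
    show "integrable T_measure (\<lambda>t. norm (g t) * exp B)"
      using g by simp
    show "AE t in T_measure. (\<lambda>n. g t * poly (q n) (circ t)) \<longlonglongrightarrow> g t * exp (poly p (circ t))"
      by (intro AE_I2 tendsto_intros lim)
    have "norm (poly (q n) (circ t)) \<le> exp B" for n t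
      unfolding q by (rule order_trans[OF norm_exp_partial_sum_le]) (simp add: B)
    then show "AE t in T_measure. norm (g t * poly (q n) (circ t)) \<le> norm (g t) * exp B" for n
      by (intro AE_I2) (simp add: norm_mult mult_left_mono)
  qed measurable
  moreover have "(\<lambda>n. LINT t|T_measure. g t * poly (q n) (circ t)) \<longlonglongrightarrow> exp (poly p 0) * fourier_coeff g 0"
    unfolding integral_mult_poly[OF assms] by (intro tendsto_intros lim)
  ultimately show ?thesis
    by (rule LIMSEQ_unique)
qed

text \<open>Turns \<open>integral_mult_poly\<close> into a mean value property. The antiderivative
  \<open>F\<close> takes equal values at 0 and 1, so the integral vanishes.\<close>

lemma analytic_type_1: "analytic_type (\<lambda>_. 1)"
  unfolding analytic_type_def
proof (intro conjI allI impI)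
  fix n :: int assume n: "n < 0"
  let ?c = "of_real (- 2 * pi * of_int n) * \<i>"
  define F where "F t = exp (?c * of_real t) / ?c" for t
  have c: "?c \<noteq> 0" using n by simp
  have "(F has_vector_derivative cis (- 2 * pi * real_of_int n * t)) (at t within {0..1})" for t
  proof -
    have "((\<lambda>z. exp (?c * z) / ?c) has_field_derivative exp (?c * of_real t)) (at (of_real t))"
      using c by (auto intro!: derivative_eq_intros)
    then have "(F has_vector_derivative exp (?c * of_real t)) (at t within {0..1})"
      unfolding F_def by (rule has_vector_derivative_real_field)
    then show ?thesis
      by (simp add: cis_conv_exp mult_ac)
  qed
  then have "(\<integral>t. indicator {0..1} t *\<^sub>R cis (- 2 * pi * real_of_int n * t) \<partial>lborel) = F 1 - F 0"
    by (intro integral_FTC_Icc) (auto simp: cis_conv_exp intro!: continuous_intros)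
  moreover have "F 1 = F 0"
  proof -
    have "exp ?c = 1"
      unfolding exp_eq_1 by (simp, rule exI[of _ "- n"]) simp
    then show ?thesis by (simp add: F_def)
  qed
  ultimately show "fourier_coeff (\<lambda>_. 1) n = 0"
    by (simp add: fourier_coeff_def T_measure_def integral_restrict_space)
qed simp

lemma fourier_coeff_1 [simp]: "fourier_coeff (\<lambda>_. 1) 0 = 1"
  by (simp add: fourier_coeff_0)

section \<open>A Jensen-type inequality\<close>

text \<open>On the circle \<open>cnj z\<close> is the inverse of \<open>z\<close>, so the product is
  a trigonometric polynomial, and under \<open>Re\<close> its negative powers can be conjugated into
  positive ones. The induction writes \<open>p\<close> as \<open>b + z p'\<close> and cancels
  \<open>z * cnj z\<close> in the product of the two tails.\<close>

lemma Re_poly_mult_cnj_poly: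
  "\<exists>r. \<forall>z. norm z = 1 \<longrightarrow> Re (poly p z * cnj (poly q z)) = Re (poly r z)"
  for p q :: "complex poly"
proof (induction q arbitrary: p)
  case 0
  show ?case by (intro exI[of _ 0]) simp
next
  case (pCons a q)
  obtain b p' where p: "p = pCons b p'"
    by (cases p)
  obtain r where r: "\<And>z. norm z = 1 \<Longrightarrow> Re (poly p' z * cnj (poly q z)) = Re (poly r z)"
    using pCons.IH by metis
  have "Re (poly p z * cnj (poly (pCons a q) z)) =
      Re (poly (smult (cnj a) p + pCons 0 (smult (cnj b) q) + r) z)" if z: "norm z = 1" for z
  proof -
    have zz: "z * cnj z = 1"
      using z by (simp add: complex_norm_square[symmetric])
    have "poly p z * cnj (poly (pCons a q) z) =
        poly p z * cnj a + b * cnj (z * poly q z) + (z * cnj z) * (poly p' z * cnj (poly q z))"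
      by (simp add: p algebra_simps)
    then have "Re (poly p z * cnj (poly (pCons a q) z)) =
        Re (poly p z * cnj a) + Re (cnj (b * cnj (z * poly q z))) + Re (poly p' z * cnj (poly q z))"
      unfolding zz by (simp only: mult_1 plus_complex.sel cnj.sel)
    moreover have "poly (smult (cnj a) p + pCons 0 (smult (cnj b) q) + r) z =
        poly p z * cnj a + cnj (b * cnj (z * poly q z)) + poly r z"
      by (simp add: algebra_simps)
    ultimately show ?thesis
      using r[OF z] by (simp only: plus_complex.sel)
  qed
  then show ?case by blast
qed

lemma real_polynomial_function_circle:
  assumes "real_polynomial_function f"
  shows "\<exists>p. \<forall>z::complex. norm z = 1 \<longrightarrow> f z = Re (poly p z)"
  using assms
proof induction
  case (linear f)
  interpret bounded_linear f by fact
  \<comment> \<open>The slope \<open>c\<close> is forced by \<open>Re c = f 1\<close> and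
    \<open>Re (c * \<i>) = f \<i>\<close>.\<close>
  have "f z = Re (poly [:0, Complex (f 1) (- f \<i>):] z)" for z
  proof -
    have "f z = f (Re z *\<^sub>R 1 + Im z *\<^sub>R \<i>)"
      by (rule arg_cong[where f = f]) (simp add: complex_eq_iff)
    also have "\<dots> = Re z * f 1 + Im z * f \<i>"
      by (simp only: add scaleR real_scaleR_def)
    finally show ?thesis by simp
  qed
  then show ?case by blast
next
  case (const c)
  show ?case by (intro exI[of _ "[:of_real c:]"]) simp
next
  case (add f g)
  then obtain p q where "\<forall>z. norm z = 1 \<longrightarrow> f z = Re (poly p z)" "\<forall>z. norm z = 1 \<longrightarrow> g z = Re (poly q z)"
    by blast
  then show ?case
    by (intro exI[of _ "p + q"]) simp
next
  case (mult f g)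
  then obtain p q where pq: "\<forall>z. norm z = 1 \<longrightarrow> f z = Re (poly p z)" "\<forall>z. norm z = 1 \<longrightarrow> g z = Re (poly q z)"
    by blast
  obtain r where r: "\<forall>z. norm z = 1 \<longrightarrow> Re (poly p z * cnj (poly q z)) = Re (poly r z)"
    using Re_poly_mult_cnj_poly by blast
  \<comment> \<open>Uses \<open>Re a * Re b = (Re (a * b) + Re (a * cnj b)) / 2\<close>, with
    \<open>r\<close> representing the second term.\<close>
  have "f z * g z = Re (poly (smult (1/2) (p * q + r)) z)" if "norm z = 1" for z
    using that pq r[rule_format, OF that, symmetric] by (simp add: field_simps)
  then show ?case by blast
qed

lemma Re_poly_approximation_on_circle:
  fixes f :: "complex \<Rightarrow> real"
  assumes "continuous_on (sphere 0 1) f" "0 < e"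
  obtains p where "\<And>z. norm z = 1 \<Longrightarrow> \<bar>f z - Re (poly p z)\<bar> < e"
proof -
  obtain g where g: "real_polynomial_function g" "\<And>z. z \<in> sphere 0 1 \<Longrightarrow> \<bar>f z - g z\<bar> < e"
    using Stone_Weierstrass_real_polynomial_function[OF _ assms] by (metis compact_sphere)
  then show ?thesis
    using real_polynomial_function_circle[OF g(1)] that by fastforce
qed

text \<open>Taking \<open>g = 1\<close> in \<open>integral_mult_poly\<close> yields the mean value
  property of the harmonic function \<open>Re p\<close>.\<close>

lemma integral_Re_poly:
  "(LINT t|T_measure. Re (poly p (circ t))) = Re (poly p 0)"
proof -
  have "integrable T_measure (\<lambda>t. 1 * poly p (circ t))"
    by (intro integrable_mult_circ[of "\<lambda>_. 1" "poly p"] continuous_on_poly_complex) simp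
  then have "(LINT t|T_measure. Re (poly p (circ t))) = Re (LINT t|T_measure. 1 * poly p (circ t))"
    by simp
  then show ?thesis
    unfolding integral_mult_poly[OF analytic_type_1] by simp
qed

lemma integrable_norm_mult_circ:
  fixes f :: "complex \<Rightarrow> real" and g :: "real \<Rightarrow> complex"
  assumes "integrable T_measure g" "continuous_on (sphere 0 1) f"
  shows "integrable T_measure (\<lambda>t. norm (g t) * f (circ t))"
proof -
  have "integrable T_measure (\<lambda>t. of_real (norm (g t)) * (of_real (f (circ t))) :: complex)"
    by (intro integrable_mult_circ[of _ "\<lambda>z. of_real (f z)"] continuous_intros assms)
       (use assms(1) in simp)
  then have "integrable T_measure (\<lambda>t. of_real (norm (g t) * f (circ t)) :: complex)"
    by simp
  then show ?thesis
    unfolding complex_of_real_integrable_eq .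
qed

text \<open>Since \<open>norm (exp p)\<close> is \<open>exp (Re p)\<close>, the triangle inequality
  for the integral of \<open>g exp p\<close> suffices. The exponential form avoids
  \<open>log |g|\<close>, which is minus infinity on the zero set of \<open>g\<close>.\<close>

lemma norm_fourier_coeff_0_le_exp_Re_poly:
  assumes "analytic_type g"
  shows "norm (fourier_coeff g 0) * exp (Re (poly p 0))
    \<le> (LINT t|T_measure. norm (g t) * exp (Re (poly p (circ t))))"
proof -
  have "norm (fourier_coeff g 0) * exp (Re (poly p 0)) =
      norm (LINT t|T_measure. g t * exp (poly p (circ t)))"
    unfolding integral_mult_exp_poly[OF assms] by (simp add: norm_mult)
  also have "\<dots> \<le> (LINT t|T_measure. norm (g t * exp (poly p (circ t))))"
    by (rule integral_norm_bound)
  finally show ?thesis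
    by (simp add: norm_mult)
qed

text \<open>The factor \<open>exp 2\<close> comes from approximating \<open>f\<close> by a trigonometric polynomial only up to
  distance 1; the factor could be removed by letting this distance tend to 0.\<close>

lemma norm_fourier_coeff_0_le_exp:
  fixes f :: "complex \<Rightarrow> real"
  assumes g: "analytic_type g" and f: "continuous_on (sphere 0 1) f"
  shows "norm (fourier_coeff g 0) * exp (LINT t|T_measure. f (circ t))
    \<le> exp 2 * (LINT t|T_measure. norm (g t) * exp (f (circ t)))"
proof -
  obtain p where p: "\<And>z. norm z = 1 \<Longrightarrow> \<bar>f z - Re (poly p z)\<bar> < 1"
    using Re_poly_approximation_on_circle[OF f] by (metis zero_less_one)
  have gi: "integrable T_measure g"
    using g by (simp add: analytic_type_def)
  have intf: "integrable T_measure (\<lambda>t. h (circ t))" if "continuous_on (sphere 0 1) h" for h :: "complex \<Rightarrow> real"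
    using integrable_norm_mult_circ[OF _ that, of "\<lambda>_. 1"] by simp
  have cp: "continuous_on (sphere 0 1) (\<lambda>z. Re (poly p z))"
    by (intro continuous_intros)
  have "(LINT t|T_measure. f (circ t)) \<le> (LINT t|T_measure. Re (poly p (circ t)) + 1)"
  proof (rule integral_mono)
    show "f (circ t) \<le> Re (poly p (circ t)) + 1" for t
      using p[of "circ t"] by (simp add: abs_less_iff)
    show "integrable T_measure (\<lambda>t. f (circ t))"
      by (rule intf[OF f])
    show "integrable T_measure (\<lambda>t. Re (poly p (circ t)) + 1)"
      using intf[OF cp] by simp
  qed
  also have "\<dots> = Re (poly p 0) + 1"
    using intf[OF cp] by (simp add: integral_Re_poly)
  finally have m: "exp (LINT t|T_measure. f (circ t)) \<le> exp 1 * exp (Re (poly p 0))"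
    by (simp flip: exp_add)
  have "(LINT t|T_measure. norm (g t) * exp (Re (poly p (circ t)))) \<le>
      (LINT t|T_measure. norm (g t) * (exp 1 * exp (f (circ t))))"
  proof (intro integral_mono)
    show "integrable T_measure (\<lambda>t. norm (g t) * exp (Re (poly p (circ t))))"
      by (intro integrable_norm_mult_circ[of _ "\<lambda>z. exp (Re (poly p z))"] gi continuous_intros)
    show "integrable T_measure (\<lambda>t. norm (g t) * (exp 1 * exp (f (circ t))))"
      by (intro integrable_norm_mult_circ[of _ "\<lambda>z. exp 1 * exp (f z)"] gi continuous_intros f)
    show "norm (g t) * exp (Re (poly p (circ t))) \<le> norm (g t) * (exp 1 * exp (f (circ t)))" for t
      using p[of "circ t"] by (intro mult_left_mono) (auto simp: abs_less_iff simp flip: exp_add)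
  qed
  also have "\<dots> = exp 1 * (LINT t|T_measure. norm (g t) * exp (f (circ t)))"
    by (simp add: mult.left_commute)
  finally have i: "norm (fourier_coeff g 0) * exp (Re (poly p 0)) \<le>
      exp 1 * (LINT t|T_measure. norm (g t) * exp (f (circ t)))"
    using norm_fourier_coeff_0_le_exp_Re_poly[OF g, of p] by linarith
  have "norm (fourier_coeff g 0) * exp (LINT t|T_measure. f (circ t)) \<le>
      norm (fourier_coeff g 0) * (exp 1 * exp (Re (poly p 0)))"
    by (intro mult_left_mono m) simp
  also have "\<dots> \<le> exp 1 * (exp 1 * (LINT t|T_measure. norm (g t) * exp (f (circ t))))"
    using i by simp
  also have "\<dots> = exp 2 * (LINT t|T_measure. norm (g t) * exp (f (circ t)))"
    by (simp flip: mult.assoc exp_add)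
  finally show ?thesis .
qed

text \<open>The approximants live on the circle because real parts of polynomials in
  \<open>circ t\<close> approximate only such functions uniformly. They are tents around the compact
  image of \<open>K\<close>: at positive distance from it they vanish from some index on.
  Convergence can fail at an endpoint outside \<open>K\<close> when the other endpoint is in
  \<open>K\<close>.\<close>

lemma compact_indicator_approximation:
  assumes K: "compact K" "K \<subseteq> {0..1}" "K \<noteq> {}"
  obtains u :: "nat \<Rightarrow> complex \<Rightarrow> real"
  where "\<And>n. continuous_on UNIV (u n)" "\<And>n z. 0 \<le> u n z" "\<And>n z. u n z \<le> 1"
    "\<And>n t. t \<in> K \<Longrightarrow> u n (circ t) = 1"
    "AE t in T_measure. (\<lambda>n. u n (circ t)) \<longlonglongrightarrow> indicator K t"
proof
  define u where "u n z = max 0 (1 - real n * infdist z (circ ` K))" for n z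
  show "continuous_on UNIV (u n)" for n
    unfolding u_def by (intro continuous_intros)
  show "0 \<le> u n z" "u n z \<le> 1" for n z
    by (auto simp: u_def infdist_nonneg)
  show u1: "u n (circ t) = 1" if "t \<in> K" for n t
    using that by (simp add: u_def)
  have cl: "closed (circ ` K)"
    by (intro compact_imp_closed compact_continuous_image K continuous_intros)
  show "AE t in T_measure. (\<lambda>n. u n (circ t)) \<longlonglongrightarrow> indicator K t"
    using AE_T_measure_interior
  proof eventually_elim
    case (elim t)
    show ?case
    proof (cases "t \<in> K")
      case True
      then show ?thesis by (simp add: u1)
    next
      case False
      have "circ t \<notin> circ ` K"
      proof
        assume "circ t \<in> circ ` K"
        then obtain s where "s \<in> K" "circ s = circ t" by auto
        with circ_eq_iff[of t s] elim K(2) False show False by auto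
      qed
      \<comment> \<open>\<open>infdist\<close> to the empty set is 0, so positivity needs a nonempty
        \<open>K\<close> as well as a closed image.\<close>
      then have d: "0 < infdist (circ t) (circ ` K)"
        using cl K(3) by (intro infdist_pos_not_in_closed) auto
      obtain N where N: "1 < real N * infdist (circ t) (circ ` K)"
        using reals_Archimedean3[OF d] by blast
      have "eventually (\<lambda>n. u n (circ t) = 0) sequentially"
        using eventually_ge_at_top[of N]
      proof eventually_elim
        case (elim n)
        then have "real N * infdist (circ t) (circ ` K) \<le> real n * infdist (circ t) (circ ` K)"
          using d by (intro mult_right_mono) auto
        with N show ?case by (simp add: u_def)
      qed
      with False show ?thesis
        by (auto intro: tendsto_eventually)
    qed
  qed
qed

text \<open>In the exponential inequality for \<open>N * u n\<close> the left side grows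
  exponentially in \<open>N\<close> unless the mean of \<open>g\<close> is 0. On the right, as
  \<open>n\<close> tends to infinity, the large weight concentrates on \<open>K\<close>, where
  \<open>g\<close> vanishes, leaving a bound independent of \<open>N\<close>.\<close>

lemma fourier_coeff_0_eq_0_if_zero_on_compact:
  assumes g: "analytic_type g"
    and K: "compact K" "K \<subseteq> {0..1}" "measure T_measure K > 0" "\<And>t. t \<in> K \<Longrightarrow> g t = 0"
  shows "fourier_coeff g 0 = 0"
proof -
  have "K \<noteq> {}" using K(3) by auto
  obtain u :: "nat \<Rightarrow> complex \<Rightarrow> real"
  where u: "\<And>n. continuous_on UNIV (u n)" "\<And>n z. 0 \<le> u n z" "\<And>n z. u n z \<le> 1"
    "\<And>n t. t \<in> K \<Longrightarrow> u n (circ t) = 1"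
    "AE t in T_measure. (\<lambda>n. u n (circ t)) \<longlonglongrightarrow> indicator K t"
    using compact_indicator_approximation[OF K(1,2) \<open>K \<noteq> {}\<close>] by blast
  have uc: "continuous_on A (u n)" for A n
    using u(1) continuous_on_subset by blast
  have [measurable]: "(\<lambda>t. u n (circ t)) \<in> borel_measurable T_measure" for n
    by (intro continuous_measurable_T continuous_on_compose2[OF u(1)] continuous_intros) auto
  have gi: "integrable T_measure g"
    using g by (simp add: analytic_type_def)
  then have [measurable]: "g \<in> borel_measurable T_measure" by auto
  have K_sets [measurable]: "K \<in> sets T_measure"
    using K by (auto simp: sets_T_measure_iff borel_compact)
  let ?k = "measure T_measure K"
  have mean: "?k \<le> (LINT t|T_measure. u n (circ t))" for n
  proof -
    have "?k = (LINT t|T_measure. indicator K t)"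
      using K(2) by (simp add: Int_absorb2)
    also have "\<dots> \<le> (LINT t|T_measure. u n (circ t))"
    proof (intro integral_mono)
      show "integrable T_measure (\<lambda>t. u n (circ t))"
        by (rule T.integrable_const_bound[where B = 1]) (use u in auto)
      show "integrable T_measure (indicator K :: real \<Rightarrow> real)"
        by (intro integrable_real_indicator K_sets) (simp add: T.emeasure_eq_measure)
    qed (auto simp: indicator_def u)
    finally show ?thesis .
  qed
  have bound: "norm (fourier_coeff g 0) * exp (N * ?k) \<le> exp 2 * (LINT t|T_measure. norm (g t))"
    if N: "0 \<le> N" for N
  proof -
    have le: "norm (fourier_coeff g 0) * exp (N * ?k) \<le>
        exp 2 * (LINT t|T_measure. norm (g t) * exp (N * u n (circ t)))" for n
    proof -
      have "N * ?k \<le> (LINT t|T_measure. N * u n (circ t))"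
        using mean[of n] N by (simp add: mult_left_mono)
      then have "norm (fourier_coeff g 0) * exp (N * ?k) \<le>
          norm (fourier_coeff g 0) * exp (LINT t|T_measure. N * u n (circ t))"
        by (intro mult_left_mono) auto
      also have "\<dots> \<le> exp 2 * (LINT t|T_measure. norm (g t) * exp (N * u n (circ t)))"
        by (intro norm_fourier_coeff_0_le_exp[OF g, of "\<lambda>z. N * u n z"] continuous_intros uc)
      finally show ?thesis .
    qed
    have "(\<lambda>n. LINT t|T_measure. norm (g t) * exp (N * u n (circ t))) \<longlonglongrightarrow>
        (LINT t|T_measure. norm (g t))"
    proof (rule integral_dominated_convergence)
      show "integrable T_measure (\<lambda>t. norm (g t) * exp N)"
        using gi by simp
      show "AE t in T_measure. (\<lambda>n. norm (g t) * exp (N * u n (circ t))) \<longlonglongrightarrow> norm (g t)"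
        using u(5)
      proof eventually_elim
        case (elim t)
        then have "(\<lambda>n. norm (g t) * exp (N * u n (circ t))) \<longlonglongrightarrow> norm (g t) * exp (N * indicator K t)"
          by (intro tendsto_intros)
        \<comment> \<open>On \<open>K\<close> the factor \<open>g t\<close> is 0, and off
          \<open>K\<close> the exponent is 0.\<close>
        then show ?case
          using K(4)[of t] by (cases "t \<in> K") auto
      qed
      show "AE t in T_measure. norm (norm (g t) * exp (N * u n (circ t))) \<le> norm (g t) * exp N" for n
        using N u(3) by (intro AE_I2) (simp add: mult_left_mono mult_left_le)
    qed measurable
    then have "(\<lambda>n. exp 2 * (LINT t|T_measure. norm (g t) * exp (N * u n (circ t)))) \<longlonglongrightarrow>
        exp 2 * (LINT t|T_measure. norm (g t))"
      by (intro tendsto_intros)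
    then show ?thesis
      by (rule LIMSEQ_le_const) (use le in blast)
  qed
  show ?thesis
  proof (rule ccontr)
    let ?c = "norm (fourier_coeff g 0)" and ?C = "exp 2 * (LINT t|T_measure. norm (g t))"
    assume "fourier_coeff g 0 \<noteq> 0"
    then have c: "0 < ?c * ?k" using K(3) by simp
    obtain N :: nat where N: "?C < real N * (?c * ?k)"
      using reals_Archimedean3[OF c] by blast
    \<comment> \<open>The crude bound \<open>x <= exp x\<close> suffices: linear growth in
      \<open>N\<close> already passes the fixed bound \<open>?C\<close>.\<close>
    have "real N * ?k \<le> exp (real N * ?k)"
      using exp_ge_add_one_self[of "real N * ?k"] by linarith
    then have "real N * (?c * ?k) \<le> ?c * exp (real N * ?k)"
      using mult_left_mono[of "real N * ?k" "exp (real N * ?k)" ?c] by (simp add: mult_ac)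
    with N bound[of "real N"] show False by simp
  qed
qed

section \<open>Uniqueness theorems\<close>

text \<open>Once the mean vanishes, dividing by \<open>circ\<close> preserves analytic type and the
  zeros on \<open>K\<close>, and lowers every index by one.\<close>

lemma fourier_coeff_nonneg_eq_0_if_zero_on_compact:
  assumes "analytic_type g"
    and "compact K" "K \<subseteq> {0..1}" "measure T_measure K > 0" "\<And>t. t \<in> K \<Longrightarrow> g t = 0"
  shows "fourier_coeff g (int m) = 0"
  using assms(1,5)
proof (induction m arbitrary: g)
  case 0
  then show ?case
    using fourier_coeff_0_eq_0_if_zero_on_compact[OF _ assms(2-4)] by simp
next
  case (Suc m)
  have "fourier_coeff g 0 = 0"
    using fourier_coeff_0_eq_0_if_zero_on_compact[OF Suc.prems(1) assms(2-4) Suc.prems(2)] .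
  \<comment> \<open>At \<open>n = - 1\<close> the coefficient of the quotient is the mean of
    \<open>g\<close>, so its vanishing enters here.\<close>
  then have "fourier_coeff (\<lambda>t. g t * cnj (circ t)) n = 0" if "n < 0" for n
    using that Suc.prems(1) unfolding fourier_coeff_mult_cnj_circ analytic_type_def
    by (cases "n = - 1") auto
  moreover have "integrable T_measure (\<lambda>t. g t * cnj (circ t))"
    using Suc.prems(1)
    by (intro integrable_mult_circ[of g cnj] continuous_intros) (simp add: analytic_type_def)
  ultimately have "analytic_type (\<lambda>t. g t * cnj (circ t))"
    by (simp add: analytic_type_def)
  from Suc.IH[OF this] Suc.prems(2) show ?case
    by (simp add: fourier_coeff_mult_cnj_circ algebra_simps)
qed

text \<open>Both \<open>g\<close> and its conjugate are of analytic type with mean 0, so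
  \<open>g\<close> annihilates polynomials in \<open>circ t\<close> and their conjugates, hence
  their real parts, which are uniformly dense among real continuous functions.\<close>

lemma integral_mult_continuous_eq_0:
  fixes f :: "complex \<Rightarrow> real"
  assumes g: "integrable T_measure g" "\<And>n. fourier_coeff g n = 0"
    and f: "continuous_on (sphere 0 1) f"
  shows "(LINT t|T_measure. g t * of_real (f (circ t))) = 0"
proof -
  have ip: "integrable T_measure (\<lambda>t. h t * poly p (circ t))" if "integrable T_measure h" for h p
    using that by (intro integrable_mult_circ[of h "poly p"] continuous_on_poly_complex)
  have poly: "(LINT t|T_measure. g t * of_real (Re (poly p (circ t)))) = 0" for p
  proof -
    have cg: "integrable T_measure (\<lambda>t. cnj (g t))"
      using g(1) by simp
    have "analytic_type g" "analytic_type (\<lambda>t. cnj (g t))"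
      using g cg by (simp_all add: analytic_type_def fourier_coeff_cnj)
    note z = this[THEN integral_mult_poly, of p]
    have "(LINT t|T_measure. g t * cnj (poly p (circ t))) = cnj (LINT t|T_measure. cnj (g t) * poly p (circ t))"
      by (simp flip: Bochner_Integration.integral_cnj)
    then have z': "(LINT t|T_measure. g t * cnj (poly p (circ t))) = 0"
      using z(2) g(2) by (simp add: fourier_coeff_cnj)
    have i: "integrable T_measure (\<lambda>t. g t * cnj (poly p (circ t)))"
      using integrable_cnj[OF ip[OF cg, of p]] by simp
    have "g t * of_real (Re (poly p (circ t))) =
        (g t * poly p (circ t) + g t * cnj (poly p (circ t))) / 2" for t
      using complex_add_cnj[of "poly p (circ t)"] by (simp add: field_simps flip: distrib_left)
    then have "(LINT t|T_measure. g t * of_real (Re (poly p (circ t)))) =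
        ((LINT t|T_measure. g t * poly p (circ t)) + (LINT t|T_measure. g t * cnj (poly p (circ t)))) / 2"
      using ip[OF g(1), of p] i by (simp only: integral_divide_zero Bochner_Integration.integral_add)
    then show ?thesis
      using z(1) z' g(2) by simp
  qed
  have "norm (LINT t|T_measure. g t * of_real (f (circ t))) \<le> 0 + e" if e: "0 < e" for e
  proof -
    \<comment> \<open>Adding 1 keeps the divisor positive even when \<open>g\<close> vanishes almost
      everywhere.\<close>
    define C where "C = (LINT t|T_measure. norm (g t)) + 1"
    have C: "C > 0"
      unfolding C_def by (intro add_nonneg_pos) auto
    obtain p where p: "\<And>z. norm z = 1 \<Longrightarrow> \<bar>f z - Re (poly p z)\<bar> < e / C"
      using Re_poly_approximation_on_circle[OF f, of "e / C"] e C by auto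
    have i1: "integrable T_measure (\<lambda>t. g t * of_real (f (circ t)))"
      by (intro integrable_mult_circ[of g "\<lambda>z. of_real (f z)"] g continuous_intros f)
    have i2: "integrable T_measure (\<lambda>t. g t * of_real (Re (poly p (circ t))))"
      by (intro integrable_mult_circ[of g "\<lambda>z. of_real (Re (poly p z))"] g continuous_intros)
    have "(LINT t|T_measure. g t * of_real (f (circ t))) =
        (LINT t|T_measure. g t * of_real (f (circ t)) - g t * of_real (Re (poly p (circ t))))"
      using i1 i2 poly[of p] by simp
    also have "norm \<dots> \<le> (LINT t|T_measure. norm (g t) * (e / C))"
    proof (rule Bochner_Integration.integral_norm_bound_integral)
      fix t
      have "g t * of_real (f (circ t)) - g t * of_real (Re (poly p (circ t))) =
          g t * of_real (f (circ t) - Re (poly p (circ t)))"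
        by (simp add: right_diff_distrib)
      then show "norm (g t * of_real (f (circ t)) - g t * of_real (Re (poly p (circ t)))) \<le> norm (g t) * (e / C)"
        using p[of "circ t"] by (simp only: norm_mult norm_of_real) (intro mult_left_mono, auto)
    qed (use i1 i2 g(1) in auto)
    also have "\<dots> = (C - 1) * (e / C)"
      by (simp add: C_def)
    also have "\<dots> \<le> e"
      using C e by (simp add: field_simps)
    finally show ?thesis by simp
  qed
  then have "norm (LINT t|T_measure. g t * of_real (f (circ t))) \<le> 0"
    by (rule field_le_epsilon)
  then show ?thesis by simp
qed

text \<open>Continuous approximants to the indicator of \<open>K\<close> are annihilated by
  \<open>g\<close> and bounded by 1, so \<open>norm (g t)\<close> is a majorant for the passage to
  the limit.\<close>

lemma set_integral_compact_eq_0: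
  assumes g: "integrable T_measure g" "\<And>n. fourier_coeff g n = 0"
    and K: "compact K" "K \<subseteq> {0..1}"
  shows "(LINT t:K|T_measure. g t) = 0"
proof (cases "K = {}")
  case False
  obtain u :: "nat \<Rightarrow> complex \<Rightarrow> real"
  where u: "\<And>n. continuous_on UNIV (u n)" "\<And>n z. 0 \<le> u n z" "\<And>n z. u n z \<le> 1"
    "\<And>n t. t \<in> K \<Longrightarrow> u n (circ t) = 1"
    "AE t in T_measure. (\<lambda>n. u n (circ t)) \<longlonglongrightarrow> indicator K t"
    using compact_indicator_approximation[OF K False] by blast
  have [measurable]: "(\<lambda>t. u n (circ t)) \<in> borel_measurable T_measure" for n
    by (intro continuous_measurable_T continuous_on_compose2[OF u(1)] continuous_intros) auto
  have [measurable]: "g \<in> borel_measurable T_measure"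
    using g(1) by auto
  have [measurable]: "K \<in> sets T_measure"
    using K by (auto simp: sets_T_measure_iff borel_compact)
  have "(\<lambda>n. LINT t|T_measure. g t * of_real (u n (circ t))) \<longlonglongrightarrow>
      (LINT t|T_measure. g t * of_real (indicator K t))"
  proof (rule integral_dominated_convergence)
    show "integrable T_measure (\<lambda>t. norm (g t))"
      using g(1) by simp
    show "AE t in T_measure. (\<lambda>n. g t * of_real (u n (circ t))) \<longlonglongrightarrow> g t * of_real (indicator K t)"
      using u(5) by eventually_elim (intro tendsto_intros)
    show "AE t in T_measure. norm (g t * of_real (u n (circ t))) \<le> norm (g t)" for n
      using u(2,3) by (intro AE_I2) (simp add: norm_mult mult_left_le)
  qed measurable
  moreover have "(LINT t|T_measure. g t * of_real (u n (circ t))) = 0" for n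
    using u(1) by (intro integral_mult_continuous_eq_0 g) (blast intro: continuous_on_subset)
  ultimately have "(LINT t|T_measure. g t * of_real (indicator K t)) = 0"
    by (simp add: LIMSEQ_const_iff)
  then show ?thesis
    by (simp add: set_lebesgue_integral_def scaleR_conv_of_real mult.commute)
qed (simp add: set_lebesgue_integral_def)

text \<open>It suffices that all set integrals of \<open>g\<close> vanish. Closed sets are an
  intersection-stable generator of the Borel sets, so Dynkin's argument extends the compact
  case.\<close>

theorem fourier_uniqueness:
  assumes g: "integrable T_measure g" "\<And>n. fourier_coeff g n = 0"
  shows "AE t in T_measure. g t = 0"
proof (rule T.density_zero[OF g(1)])
  have si: "set_integrable T_measure A g" if "A \<in> sets T_measure" for A
    using that g(1) unfolding set_integrable_def by (intro integrable_mult_indicator)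
  have restr: "B \<inter> {0..1} \<in> sets T_measure" if "B \<in> sets borel" for B
    using that by (auto simp: sets_T_measure_iff)
  have all: "(LINT t:{0..1}|T_measure. g t) = 0"
    by (intro set_integral_compact_eq_0 g) auto
  fix A assume "A \<in> sets T_measure"
  then have A: "A \<in> sigma_sets UNIV (Collect closed)" "A \<inter> {0..1} = A"
    by (auto simp: sets_T_measure_iff borel_eq_closed)
  have eq: "B \<in> sets borel" if "B \<in> sigma_sets UNIV (Collect closed)" for B :: "real set"
    using that by (simp add: borel_eq_closed)
  have "Int_stable (Collect closed :: real set set)"
    by (auto simp: Int_stable_def)
  moreover have "Collect closed \<subseteq> Pow (UNIV :: real set)"
    by auto
  moreover note A(1)
  \<comment> \<open>The induction runs over Borel sets of the line with complements in
    \<open>UNIV\<close>; intersecting with \<open>{0..1}\<close> makes closed sets compact and stays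
    in the measure space.\<close>
  ultimately have "(LINT t:(A \<inter> {0..1})|T_measure. g t) = 0"
  proof (induction A rule: sigma_sets_induct_disjoint)
    case (basic C)
    then show ?case
      by (intro set_integral_compact_eq_0 g) (auto intro: closed_Int_compact)
  next
    case empty
    then show ?case by (simp add: set_lebesgue_integral_def)
  next
    case (compl B)
    have B: "B \<inter> {0..1} \<in> sets T_measure" "(UNIV - B) \<inter> {0..1} \<in> sets T_measure"
      using eq[OF compl.hyps] by (auto intro: restr)
    have "{0..1} = (B \<inter> {0..1}) \<union> ((UNIV - B) \<inter> {0..1})"
      by auto
    then have "(LINT t:{0..1}|T_measure. g t) =
        (LINT t:(B \<inter> {0..1}) \<union> ((UNIV - B) \<inter> {0..1})|T_measure. g t)"
      by simp
    also have "\<dots> = (LINT t:(B \<inter> {0..1})|T_measure. g t) + (LINT t:((UNIV - B) \<inter> {0..1})|T_measure. g t)"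
      using B by (intro set_integral_Un si) auto
    finally show ?case
      using all compl.IH by simp
  next
    case (union B)
    have B: "B i \<in> sets borel" for i
      using union.hyps by (intro eq) auto
    have "(\<Union>i. B i) \<inter> {0..1} = (\<Union>i. B i \<inter> {0..1})"
      by auto
    moreover have "(LINT t:(\<Union>i. B i \<inter> {0..1})|T_measure. g t) = (\<Sum>i. LINT t:(B i \<inter> {0..1})|T_measure. g t)"
      using union.hyps(1) B
      by (intro lebesgue_integral_countable_add si sets.countable_UN' restr)
         (auto simp: disjoint_family_on_def intro: restr)
    ultimately show ?case
      using union.IH by simp
  qed
  then show "(LINT t:A|T_measure. g t) = 0"
    unfolding A(2) .
qed

text \<open>Inner regularity with the measure of \<open>E\<close> itself as tolerance:
  \<open>E - K\<close> has strictly smaller measure than \<open>E\<close>, so \<open>K\<close> is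
  not null.\<close>

lemma positive_measure_contains_compact:
  assumes "E \<in> sets T_measure" "measure T_measure E > 0"
  obtains K where "compact K" "K \<subseteq> E" "measure T_measure K > 0"
proof -
  have E: "E \<subseteq> {0..1}" "E \<in> sets borel"
    using assms(1) by (auto simp: sets_T_measure_iff)
  obtain K where K: "closed K" "K \<subseteq> E" "E - K \<in> lmeasurable"
      "emeasure lebesgue (E - K) < ennreal (measure T_measure E)"
    using sets_lebesgue_inner_closed[OF _ assms(2), of E] E by auto
  have cK: "compact K"
    using K(1,2) E(1) by (metis bounded_closed_interval bounded_subset compact_eq_bounded_closed subset_trans)
  have KT: "K \<in> sets T_measure" "E - K \<in> sets T_measure"
    using K E cK by (auto simp: sets_T_measure_iff borel_compact)
  have "emeasure T_measure (E - K) = emeasure lebesgue (E - K)"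
    using E KT by (subst emeasure_T_measure) (auto simp: sets_T_measure_iff)
  then have "measure T_measure (E - K) < measure T_measure E"
    using K(4) by (metis T.emeasure_eq_measure ennreal_less_iff measure_nonneg)
  moreover have "measure T_measure (E - K) = measure T_measure E - measure T_measure K"
    using K(2) KT assms(1) by (intro T.finite_measure_Diff)
  ultimately show thesis
    using that[OF cK K(2)] by simp
qed

text \<open>A zero set of positive measure contains a compact one, which kills the coefficients at
  nonnegative indices; the others vanish by analyticity, and Fourier uniqueness applies.\<close>

theorem analytic_type_nonzero_AE:
  assumes g: "analytic_type g" and nz: "\<not> (AE t in T_measure. g t = 0)"
  shows "AE t in T_measure. g t \<noteq> 0"
proof (rule ccontr)
  assume contr: "\<not> (AE t in T_measure. g t \<noteq> 0)"
  have gi: "integrable T_measure g"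
    using g by (simp add: analytic_type_def)
  then have [measurable]: "g \<in> borel_measurable T_measure" by auto
  define E where "E = {t \<in> space T_measure. g t = 0}"
  have E: "E \<in> sets T_measure"
    unfolding E_def by measurable
  have "emeasure T_measure E \<noteq> 0"
    using contr AE_iff_measurable[OF E, of "\<lambda>t. g t \<noteq> 0"] by (simp add: E_def)
  then have "measure T_measure E > 0"
    by (simp add: T.emeasure_eq_measure zero_less_measure_iff)
  with E obtain K where K: "compact K" "K \<subseteq> E" "measure T_measure K > 0"
    using positive_measure_contains_compact by blast
  have K': "K \<subseteq> {0..1}" "\<And>t. t \<in> K \<Longrightarrow> g t = 0"
    using K(2) by (auto simp: E_def)
  have "fourier_coeff g n = 0" for n
  proof (cases "n < 0")
    case True
    then show ?thesis using g by (simp add: analytic_type_def)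
  next
    case False
    then show ?thesis
      using fourier_coeff_nonneg_eq_0_if_zero_on_compact[OF g K(1) K'(1) K(3) K'(2), of "nat n"] by simp
  qed
  then have "AE t in T_measure. g t = 0"
    by (rule fourier_uniqueness[OF gi])
  with nz show False by simp
qed

section \<open>Orthogonal projection and the main theorem\<close>

lemma cmod_diff_mult_square:
  "(cmod (a - c * u))\<^sup>2 = (cmod a)\<^sup>2 - 2 * Re (cnj c * (a * cnj u)) + (cmod c)\<^sup>2 * (cmod u)\<^sup>2"
proof -
  have "complex_of_real ((cmod (a - c * u))\<^sup>2) = of_real ((cmod a)\<^sup>2)
      - (cnj c * (a * cnj u) + cnj (cnj c * (a * cnj u))) + of_real ((cmod c)\<^sup>2 * (cmod u)\<^sup>2)"
    by (simp add: complex_norm_square algebra_simps del: of_real_power)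
  also have "\<dots> = of_real ((cmod a)\<^sup>2 - 2 * Re (cnj c * (a * cnj u)) + (cmod c)\<^sup>2 * (cmod u)\<^sup>2)"
    by (simp only: complex_add_cnj of_real_add of_real_diff)
  finally show ?thesis
    by (simp only: of_real_eq_iff)
qed

lemma borel_measurable_cnj [measurable (raw)]:
  "f \<in> borel_measurable M \<Longrightarrow> (\<lambda>t. cnj (f t)) \<in> borel_measurable M"
  by (rule borel_measurable_continuous_on[OF continuous_on_cnj[OF continuous_on_id]])

lemma in_L2_measurable: "in_L2 f \<Longrightarrow> f \<in> borel_measurable T_measure"
  by (simp add: in_L2_def)

lemma in_L2_integrable: "in_L2 f \<Longrightarrow> integrable T_measure f"
proof (rule Bochner_Integration.integrable_bound)
  assume f: "in_L2 f"
  then show "integrable T_measure (\<lambda>t. 1 + (cmod (f t))\<^sup>2)"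
    by (simp add: in_L2_def)
  have "x \<le> 1 + x\<^sup>2" for x :: real
    using zero_le_power2[of "x - 1/2"] by (simp add: power2_eq_square algebra_simps)
  then show "AE t in T_measure. norm (f t) \<le> norm (1 + (cmod (f t))\<^sup>2)"
    by (intro AE_I2) (simp add: add_nonneg_nonneg)
qed (simp add: in_L2_def)

lemma in_L2_mult_cnj_integrable:
  assumes "in_L2 f" "in_L2 g"
  shows "integrable T_measure (\<lambda>t. f t * cnj (g t))"
proof (rule Bochner_Integration.integrable_bound)
  show "integrable T_measure (\<lambda>t. (cmod (f t))\<^sup>2 + (cmod (g t))\<^sup>2)"
    using assms by (simp add: in_L2_def)
  show "(\<lambda>t. f t * cnj (g t)) \<in> borel_measurable T_measure"
    using assms[THEN in_L2_measurable] by (intro borel_measurable_times borel_measurable_cnj)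
  have "x * y \<le> x\<^sup>2 + y\<^sup>2" for x y :: real
    using sum_squares_bound[of x y] zero_le_power2[of x] zero_le_power2[of y] by linarith
  then show "AE t in T_measure. norm (f t * cnj (g t)) \<le> norm ((cmod (f t))\<^sup>2 + (cmod (g t))\<^sup>2)"
    by (intro AE_I2) (simp add: norm_mult)
qed

text \<open>The expansion in \<open>c\<close> has two uses: \<open>c = - 1\<close> gives Pythagoras
  for the projection, and a small multiple of the inner product is the variation that proves
  orthogonality.\<close>

lemma
  assumes a: "in_L2 a" and u: "in_L2 u"
  shows in_L2_diff_mult: "in_L2 (\<lambda>t. a t - c * u t)"
    and integral_cmod_diff_mult_square: "(LINT t|T_measure. (cmod (a t - c * u t))\<^sup>2) =
      (LINT t|T_measure. (cmod (a t))\<^sup>2) - 2 * Re (cnj c * L2_inner a u)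
      + (cmod c)\<^sup>2 * (LINT t|T_measure. (cmod (u t))\<^sup>2)"
proof -
  have i: "integrable T_measure (\<lambda>t. (cmod (a t))\<^sup>2)" "integrable T_measure (\<lambda>t. (cmod (u t))\<^sup>2)"
    using a u by (simp_all add: in_L2_def)
  have j: "integrable T_measure (\<lambda>t. cnj c * (a t * cnj (u t)))"
    using in_L2_mult_cnj_integrable[OF a u] by simp
  note ij = integrable_Re[OF j] i
  have int: "integrable T_measure (\<lambda>t. (cmod (a t))\<^sup>2 - 2 * Re (cnj c * (a t * cnj (u t))) + (cmod c)\<^sup>2 * (cmod (u t))\<^sup>2)"
    by (intro Bochner_Integration.integrable_add Bochner_Integration.integrable_diff
        integrable_mult_right ij)
  moreover have "(\<lambda>t. a t - c * u t) \<in> borel_measurable T_measure"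
    using a u by (intro borel_measurable_diff borel_measurable_times borel_measurable_const in_L2_measurable)
  ultimately show "in_L2 (\<lambda>t. a t - c * u t)"
    unfolding in_L2_def cmod_diff_mult_square by blast
  have "(LINT t|T_measure. Re (cnj c * (a t * cnj (u t)))) = Re (cnj c * L2_inner a u)"
    unfolding L2_inner_def using j by (simp only: integral_Re integral_mult_right_zero)
  moreover have "(LINT t|T_measure. (cmod (a t))\<^sup>2 - 2 * Re (cnj c * (a t * cnj (u t))) + (cmod c)\<^sup>2 * (cmod (u t))\<^sup>2) =
      (LINT t|T_measure. (cmod (a t))\<^sup>2) - 2 * (LINT t|T_measure. Re (cnj c * (a t * cnj (u t))))
      + (cmod c)\<^sup>2 * (LINT t|T_measure. (cmod (u t))\<^sup>2)"
    using ij by (simp only: Bochner_Integration.integral_add Bochner_Integration.integral_diff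
        integral_mult_right_zero integrable_mult_right Bochner_Integration.integrable_diff)
  ultimately show "(LINT t|T_measure. (cmod (a t - c * u t))\<^sup>2) =
      (LINT t|T_measure. (cmod (a t))\<^sup>2) - 2 * Re (cnj c * L2_inner a u)
      + (cmod c)\<^sup>2 * (LINT t|T_measure. (cmod (u t))\<^sup>2)"
    unfolding cmod_diff_mult_square by (simp only:)
qed

lemma in_L2_diff: "in_L2 a \<Longrightarrow> in_L2 u \<Longrightarrow> in_L2 (\<lambda>t. a t - u t)"
  using in_L2_diff_mult[of a u 1] by simp

lemma in_L2_cnj: "in_L2 f \<Longrightarrow> in_L2 (\<lambda>t. cnj (f t))"
  by (simp add: in_L2_def borel_measurable_cnj)

lemma H2_in_L2: "f \<in> H2 \<Longrightarrow> in_L2 f"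
  by (simp add: H2_def)

lemma H2_diff_mult:
  assumes "f \<in> H2" "g \<in> H2"
  shows "(\<lambda>t. f t - c * g t) \<in> H2"
proof -
  have int: "integrable T_measure (\<lambda>t. h t * cis (- 2 * pi * real_of_int n * t))" if "h \<in> H2" for h n
    by (rule integrable_mult_bounded[where B = 1])
       (auto intro!: in_L2_integrable[OF H2_in_L2[OF that]] continuous_measurable_T continuous_intros
          simp: cis_conv_exp)
  have "fourier_coeff (\<lambda>t. f t - c * g t) n = fourier_coeff f n - c * fourier_coeff g n" for n
    unfolding fourier_coeff_def left_diff_distrib mult.assoc[of c]
    using int[OF assms(1), of n] int[OF assms(2), of n]
    by (simp only: Bochner_Integration.integral_diff integrable_mult_right integral_mult_right_zero)
  then show ?thesis
    using assms in_L2_diff_mult[of f g c] by (simp add: H2_def)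
qed

text \<open>Integrating \<open>2 r x <= r^2 + x^2\<close> replaces Cauchy-Schwarz; total mass 1
  makes the constant come out as \<open>r\<close>.\<close>

lemma integral_norm_le_if_integral_square_le:
  fixes f :: "real \<Rightarrow> complex"
  assumes f: "in_L2 f" and "0 < r" and le: "(LINT t|T_measure. (cmod (f t))\<^sup>2) \<le> r\<^sup>2"
  shows "(LINT t|T_measure. cmod (f t)) \<le> r"
proof -
  have i: "integrable T_measure (\<lambda>t. (cmod (f t))\<^sup>2)"
    using f by (simp add: in_L2_def)
  have "2 * r * (LINT t|T_measure. cmod (f t)) = (LINT t|T_measure. 2 * r * cmod (f t))"
    by simp
  also have "\<dots> \<le> (LINT t|T_measure. r\<^sup>2 + (cmod (f t))\<^sup>2)"
    using in_L2_integrable[OF f] i sum_squares_bound[of r] by (intro integral_mono) auto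
  also have "\<dots> \<le> 2 * r * r"
    using i le by (simp add: power2_eq_square)
  finally show ?thesis
    using \<open>0 < r\<close> by simp
qed

text \<open>As in the Riesz-Fischer theorem, the sum of the norms of the increments has finite
  integral, hence is finite almost everywhere; telescoping gives convergence, and this sum plus
  \<open>norm (f 0 t)\<close> is the majorant.\<close>

lemma AE_convergent_if_summable_integral_norm_diff:
  fixes f :: "nat \<Rightarrow> 'a \<Rightarrow> complex"
  assumes f: "\<And>n. integrable M (f n)"
    and sum: "summable (\<lambda>n. LINT t|M. norm (f (Suc n) t - f n t))"
  obtains w where "integrable M w" "\<And>n. AE t in M. norm (f n t) \<le> w t"
    "AE t in M. convergent (\<lambda>n. f n t)"
proof
  define v where "v n t = f (Suc n) t - f n t" for n t
  have v: "integrable M (v n)" for n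
    unfolding v_def using f by simp
  then have [measurable]: "v n \<in> borel_measurable M" for n
    by auto
  have "(\<integral>\<^sup>+t. (\<Sum>n. ennreal (norm (v n t))) \<partial>M) = (\<Sum>n. \<integral>\<^sup>+t. ennreal (norm (v n t)) \<partial>M)"
    by (intro nn_integral_suminf) measurable
  also have "\<dots> = (\<Sum>n. ennreal (LINT t|M. norm (v n t)))"
    using v by (intro suminf_cong nn_integral_eq_integral) auto
  also have "\<dots> \<noteq> \<infinity>"
    using sum by (simp add: ennreal_suminf_neq_top v_def)
  finally have "AE t in M. (\<Sum>n. ennreal (norm (v n t))) \<noteq> \<infinity>"
    by (intro nn_integral_PInf_AE) auto
  then have summ: "AE t in M. summable (\<lambda>n. norm (v n t))"
    by eventually_elim (intro summable_suminf_not_top, auto)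
  have tele: "f n t = f 0 t + (\<Sum>i<n. v i t)" for n t
    using sum_lessThan_telescope[of "\<lambda>i. f i t" n] by (simp add: v_def)
  define w where "w t = norm (f 0 t) + (\<Sum>n. norm (v n t))" for t
  show "integrable M w"
    unfolding w_def using f v summ sum
    by (intro Bochner_Integration.integrable_add integrable_suminf integrable_norm) (auto simp: v_def)
  show "AE t in M. norm (f n t) \<le> w t" for n
    using summ
  proof eventually_elim
    case (elim t)
    have "norm (f n t) \<le> norm (f 0 t) + norm (\<Sum>i<n. v i t)"
      unfolding tele[of n] by (rule norm_triangle_ineq)
    also have "norm (\<Sum>i<n. v i t) \<le> (\<Sum>i<n. norm (v i t))"
      by (rule norm_sum)
    also have "\<dots> \<le> (\<Sum>i. norm (v i t))"
      using elim by (intro sum_le_suminf) auto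
    finally show ?case by (simp add: w_def)
  qed
  show "AE t in M. convergent (\<lambda>n. f n t)"
    using summ
  proof eventually_elim
    case (elim t)
    then have "(\<lambda>n. \<Sum>i<n. v i t) \<longlonglongrightarrow> (\<Sum>i. v i t)"
      by (rule summable_LIMSEQ[OF summable_norm_cancel])
    then have "(\<lambda>n. f 0 t + (\<Sum>i<n. v i t)) \<longlonglongrightarrow> f 0 t + (\<Sum>i. v i t)"
      by (intro tendsto_intros)
    then have "(\<lambda>n. f n t) \<longlonglongrightarrow> f 0 t + (\<Sum>i. v i t)"
      by (simp only: tele[symmetric])
    then show ?case by (rule convergentI)
  qed
qed

text \<open>A minimising sequence is Cauchy by the parallelogram law. Its almost everywhere limit
  keeps vanishing negative coefficients by dominated convergence, and attains the infimum by Fatou's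
  lemma.\<close>

lemma H2_distance_attained:
  assumes h: "in_L2 h"
  obtains k where "k \<in> H2"
    "\<And>f. f \<in> H2 \<Longrightarrow> (LINT t|T_measure. (cmod (h t - k t))\<^sup>2) \<le> (LINT t|T_measure. (cmod (h t - f t))\<^sup>2)"
proof -
  define D where "D f = (LINT t|T_measure. (cmod (h t - f t))\<^sup>2)" for f
  define d where "d = Inf (D ` H2)"
  have D0: "0 \<le> D f" for f
    by (simp add: D_def)
  have bdd: "bdd_below (D ` H2)"
    using D0 by (intro bdd_belowI[of _ 0]) auto
  have "(\<lambda>_. 0) \<in> H2"
    by (simp add: H2_def in_L2_def fourier_coeff_def)
  then have ne: "D ` H2 \<noteq> {}"
    by auto
  have d_le: "d \<le> D f" if "f \<in> H2" for f
    unfolding d_def using bdd that by (intro cInf_lower) auto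
  have d0: "0 \<le> d"
    unfolding d_def using ne D0 by (intro cInf_greatest) auto
  \<comment> \<open>Ratio 1/4 makes the square roots, which bound successive distances, summable
    with ratio 1/2.\<close>
  have "\<exists>f\<in>H2. D f < d + (1/4) ^ n" for n
  proof -
    have "Inf (D ` H2) < d + (1/4) ^ n"
      by (simp add: d_def)
    then show ?thesis
      using cInf_lessD[OF ne] by blast
  qed
  then obtain f where f: "\<And>n. f n \<in> H2" and Df: "\<And>n. D (f n) < d + (1/4) ^ n"
    by metis
  note fL2 = f[THEN H2_in_L2]
  have sq: "(LINT t|T_measure. (cmod (f (Suc n) t - f n t))\<^sup>2) \<le> (2 * (1/2) ^ n)\<^sup>2" for n
  proof -
    \<comment> \<open>Parallelogram law for \<open>h - f n\<close> and \<open>h - f (Suc n)\<close>, whose midpoint is \<open>h - m\<close>.\<close>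
    define m where "m t = f n t - (- 1/2) * (f (Suc n) t - 1 * f n t)" for t
    have m: "m \<in> H2"
      unfolding m_def by (intro H2_diff_mult f)
    have i: "integrable T_measure (\<lambda>t. (cmod (h t - g t))\<^sup>2)" if "in_L2 g" for g
      using in_L2_diff[OF h that] by (simp add: in_L2_def)
    have "(cmod (f (Suc n) t - f n t))\<^sup>2 =
        2 * (cmod (h t - f n t))\<^sup>2 + 2 * (cmod (h t - f (Suc n) t))\<^sup>2 - 4 * (cmod (h t - m t))\<^sup>2" for t
      unfolding m_def cmod_power2 by (simp add: power2_eq_square field_simps)
    then have "(LINT t|T_measure. (cmod (f (Suc n) t - f n t))\<^sup>2) = 2 * D (f n) + 2 * D (f (Suc n)) - 4 * D m"
      unfolding D_def using i[OF fL2[of n]] i[OF fL2[of "Suc n"]] i[OF H2_in_L2[OF m]] by simp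
    \<comment> \<open>The estimates leave the factor 5/2; it is rounded up to 4 to obtain a perfect
      square.\<close>
    also have "\<dots> \<le> 4 * (1/4) ^ n"
    proof -
      have "(1/4::real) ^ Suc n = (1/4) ^ n / 4" "0 \<le> (1/4::real) ^ n"
        by simp_all
      then show ?thesis
        using Df[of n] Df[of "Suc n"] d_le[OF m] by linarith
    qed
    also have "\<dots> = (2 * (1/2) ^ n)\<^sup>2"
      by (simp add: power2_eq_square flip: power_mult_distrib)
    finally show ?thesis .
  qed
  have "summable (\<lambda>n. LINT t|T_measure. norm (f (Suc n) t - f n t))"
  proof (rule summable_comparison_test')
    show "summable (\<lambda>n. 2 * (1/2 :: real) ^ n)"
      by (intro summable_mult summable_geometric) simp
    show "norm (LINT t|T_measure. norm (f (Suc n) t - f n t)) \<le> 2 * (1/2) ^ n" for n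
      using integral_norm_le_if_integral_square_le[OF in_L2_diff[OF fL2 fL2] _ sq, of n] by simp
  qed
  then obtain w where w: "integrable T_measure w" "\<And>n. AE t in T_measure. norm (f n t) \<le> w t"
    "AE t in T_measure. convergent (\<lambda>n. f n t)"
    using AE_convergent_if_summable_integral_norm_diff[of T_measure f] in_L2_integrable[OF fL2] by blast
  define k where "k t = lim (\<lambda>n. f n t)" for t
  have lim: "AE t in T_measure. (\<lambda>n. f n t) \<longlonglongrightarrow> k t"
    using w(3) by eventually_elim (simp add: k_def convergent_LIMSEQ_iff)
  have [measurable]: "f n \<in> borel_measurable T_measure" "h \<in> borel_measurable T_measure" for n
    using fL2 h by (auto intro: in_L2_measurable)
  have [measurable]: "k \<in> borel_measurable T_measure"
    unfolding k_def[abs_def] by measurable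
  have coeff: "fourier_coeff k j = 0" if "j < 0" for j
  proof -
    have [measurable]: "(\<lambda>t. cis (- 2 * pi * real_of_int j * t)) \<in> borel_measurable T_measure"
      by (intro continuous_measurable_T) (simp add: cis_conv_exp, intro continuous_intros)
    have "(\<lambda>n. fourier_coeff (f n) j) \<longlonglongrightarrow> fourier_coeff k j"
      unfolding fourier_coeff_def
    proof (rule integral_dominated_convergence[OF _ _ w(1)])
      show "AE t in T_measure. (\<lambda>n. f n t * cis (- 2 * pi * real_of_int j * t)) \<longlonglongrightarrow>
          k t * cis (- 2 * pi * real_of_int j * t)"
        using lim by eventually_elim (intro tendsto_intros)
      show "AE t in T_measure. norm (f n t * cis (- 2 * pi * real_of_int j * t)) \<le> w t" for n
        using w(2)[of n] by (simp add: norm_mult)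
    qed measurable
    then show ?thesis
      using f that by (simp add: H2_def LIMSEQ_const_iff)
  qed
  \<comment> \<open>Nonnegative integrals are used because \<open>k\<close> is not yet known to be
    square integrable.\<close>
  have "(\<integral>\<^sup>+t. ennreal ((cmod (h t - k t))\<^sup>2) \<partial>T_measure) =
      (\<integral>\<^sup>+t. liminf (\<lambda>n. ennreal ((cmod (h t - f n t))\<^sup>2)) \<partial>T_measure)"
  proof (rule nn_integral_cong_AE)
    show "AE t in T_measure. ennreal ((cmod (h t - k t))\<^sup>2) = liminf (\<lambda>n. ennreal ((cmod (h t - f n t))\<^sup>2))"
      using lim
    proof eventually_elim
      case (elim t)
      then have "(\<lambda>n. ennreal ((cmod (h t - f n t))\<^sup>2)) \<longlonglongrightarrow> ennreal ((cmod (h t - k t))\<^sup>2)"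
        by (intro tendsto_ennrealI tendsto_intros)
      then show ?case
        by (rule lim_imp_Liminf[OF sequentially_bot, symmetric])
    qed
  qed
  also have "\<dots> \<le> liminf (\<lambda>n. \<integral>\<^sup>+t. ennreal ((cmod (h t - f n t))\<^sup>2) \<partial>T_measure)"
    by (intro nn_integral_liminf) measurable
  also have "\<dots> \<le> liminf (\<lambda>n. ennreal (d + (1/4) ^ n))"
  proof (intro Liminf_mono always_eventually allI)
    fix n
    have "(\<integral>\<^sup>+t. ennreal ((cmod (h t - f n t))\<^sup>2) \<partial>T_measure) = ennreal (D (f n))"
      unfolding D_def using in_L2_diff[OF h fL2[of n]] by (intro nn_integral_eq_integral) (auto simp: in_L2_def)
    also have "\<dots> \<le> ennreal (d + (1/4) ^ n)"
      using Df[of n] by (intro ennreal_leI) simp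
    finally show "(\<integral>\<^sup>+t. ennreal ((cmod (h t - f n t))\<^sup>2) \<partial>T_measure) \<le> ennreal (d + (1/4) ^ n)" .
  qed
  also have "\<dots> = ennreal d"
  proof (rule lim_imp_Liminf)
    have "(\<lambda>n. d + (1/4) ^ n) \<longlonglongrightarrow> d + 0"
      by (intro tendsto_intros LIMSEQ_power_zero) simp
    then show "(\<lambda>n. ennreal (d + (1/4) ^ n)) \<longlonglongrightarrow> ennreal d"
      by (intro tendsto_ennrealI) simp
  qed simp
  finally have fatou: "(\<integral>\<^sup>+t. ennreal ((cmod (h t - k t))\<^sup>2) \<partial>T_measure) \<le> ennreal d" .
  have int: "integrable T_measure (\<lambda>t. (cmod (h t - k t))\<^sup>2)"
    using fatou by (intro integrableI_nonneg) (auto intro: le_less_trans)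
  then have "in_L2 (\<lambda>t. h t - k t)"
    by (simp add: in_L2_def)
  from in_L2_diff[OF h this] have "in_L2 k"
    by simp
  with coeff have k: "k \<in> H2"
    by (simp add: H2_def)
  have "D k \<le> d"
    using fatou nn_integral_eq_integral[OF int] d0 by (simp add: D_def)
  then show thesis
    using that[OF k] d_le unfolding D_def by (meson order_trans)
qed

text \<open>If the error \<open>h - k\<close> of a nearest point had a nonzero inner product
  \<open>I\<close> with \<open>u\<close>, moving \<open>k\<close> slightly in the direction
  \<open>I * u\<close> would reduce the distance.\<close>

lemma H2_projection_exists:
  assumes h: "in_L2 h"
  obtains k where "k \<in> H2" "\<And>u. u \<in> H2 \<Longrightarrow> L2_inner (\<lambda>t. h t - k t) u = 0"
proof -
  obtain k where k: "k \<in> H2" and min: "\<And>f. f \<in> H2 \<Longrightarrow>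
      (LINT t|T_measure. (cmod (h t - k t))\<^sup>2) \<le> (LINT t|T_measure. (cmod (h t - f t))\<^sup>2)"
    using H2_distance_attained[OF h] by blast
  have "L2_inner (\<lambda>t. h t - k t) u = 0" if u: "u \<in> H2" for u
  proof -
    define a where "a t = h t - k t" for t
    have a: "in_L2 a"
      unfolding a_def by (rule in_L2_diff[OF h H2_in_L2[OF k]])
    define I where "I = L2_inner a u"
    define U where "U = (LINT t|T_measure. (cmod (u t))\<^sup>2)"
    have U: "0 \<le> U" by (simp add: U_def)
    \<comment> \<open>Any positive \<open>s\<close> with \<open>s * U < 2\<close> works; the added 1
      avoids division by zero.\<close>
    define s where "s = 1 / (U + 1)"
    have s: "0 < s" "s * U < 1"
      using U by (simp_all add: s_def field_simps)
    have "(\<lambda>t. k t - (- (of_real s * I)) * u t) \<in> H2"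
      by (intro H2_diff_mult k u)
    from min[OF this] have "(LINT t|T_measure. (cmod (a t))\<^sup>2) \<le>
        (LINT t|T_measure. (cmod (a t - of_real s * I * u t))\<^sup>2)"
      by (simp add: a_def algebra_simps)
    also have "\<dots> = (LINT t|T_measure. (cmod (a t))\<^sup>2) - 2 * Re (cnj (of_real s * I) * I)
        + (cmod (of_real s * I))\<^sup>2 * U"
      unfolding integral_cmod_diff_mult_square[OF a H2_in_L2[OF u]] I_def U_def ..
    also have "Re (cnj (of_real s * I) * I) = s * (cmod I)\<^sup>2"
      unfolding cmod_power2 by (simp add: power2_eq_square algebra_simps)
    also have "(cmod (of_real s * I))\<^sup>2 = s * s * (cmod I)\<^sup>2"
      by (simp add: norm_mult power2_eq_square)
    finally have "s * (cmod I)\<^sup>2 * (2 - s * U) \<le> 0"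
      by (simp add: algebra_simps)
    then have "(cmod I)\<^sup>2 \<le> 0"
      using s by (simp add: mult_le_0_iff)
    then show ?thesis
      by (simp add: I_def a_def[abs_def])
  qed
  with k show thesis by (rule that)
qed

text \<open>The choice in \<open>conjP\<close> is meaningful once some projection exists; one is the
  conjugate of the \<open>H2\<close> projection of the conjugate of \<open>h\<close>.\<close>

lemma is_conj_proj_conjP:
  assumes h: "in_L2 h"
  shows "is_conj_proj h (conjP h)"
proof -
  obtain k where k: "k \<in> H2" "\<And>u. u \<in> H2 \<Longrightarrow> L2_inner (\<lambda>t. cnj (h t) - k t) u = 0"
    using H2_projection_exists[OF in_L2_cnj[OF h]] by blast
  have "is_conj_proj h (\<lambda>t. cnj (k t))"
    unfolding is_conj_proj_def
  proof (intro conjI ballI)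
    show "(\<lambda>t. cnj (k t)) \<in> conj_H2"
      using k(1) by (auto simp: conj_H2_def)
    fix u assume "u \<in> conj_H2"
    then obtain v where v: "v \<in> H2" "\<And>t. u t = cnj (v t)"
      by (auto simp: conj_H2_def)
    have "L2_inner (\<lambda>t. h t - cnj (k t)) u = (LINT t|T_measure. cnj ((cnj (h t) - k t) * cnj (v t)))"
      by (simp add: L2_inner_def v(2))
    also have "\<dots> = cnj (L2_inner (\<lambda>t. cnj (h t) - k t) v)"
      unfolding L2_inner_def by (rule Bochner_Integration.integral_cnj)
    finally show "L2_inner (\<lambda>t. h t - cnj (k t)) u = 0"
      using k(2)[OF v(1)] by simp
  qed
  then show ?thesis
    unfolding conjP_def by (rule someI[where P = "is_conj_proj h"])
qed

lemma conj_H2_in_L2: "f \<in> conj_H2 \<Longrightarrow> in_L2 f"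
proof -
  assume "f \<in> conj_H2"
  then obtain g where "g \<in> H2" "f = (\<lambda>t. cnj (g t))"
    by (auto simp: conj_H2_def)
  then show ?thesis
    by (simp add: in_L2_cnj H2_in_L2)
qed

text \<open>The projection is itself an admissible test function, so it is orthogonal to the error
  and Pythagoras applies.\<close>

lemma L2_norm_conjP_le:
  assumes h: "in_L2 h"
  shows "L2_norm (conjP h) \<le> L2_norm h"
proof -
  define k where "k = conjP h"
  have k: "k \<in> conj_H2" "L2_inner (\<lambda>t. h t - k t) k = 0"
    using is_conj_proj_conjP[OF h] by (auto simp: is_conj_proj_def k_def)
  have "(LINT t|T_measure. (cmod (h t))\<^sup>2) = (LINT t|T_measure. (cmod ((h t - k t) - (- 1) * k t))\<^sup>2)"
    by simp
  also have "\<dots> = (LINT t|T_measure. (cmod (h t - k t))\<^sup>2) + (LINT t|T_measure. (cmod (k t))\<^sup>2)"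
    using integral_cmod_diff_mult_square[of "\<lambda>t. h t - k t" k "- 1"] k conj_H2_in_L2[OF k(1)]
      in_L2_diff[OF h, of k] by simp
  finally have "(LINT t|T_measure. (cmod (k t))\<^sup>2) \<le> (LINT t|T_measure. (cmod (h t))\<^sup>2)"
    by simp
  then show ?thesis
    by (simp add: L2_norm_def k_def)
qed

section \<open>Norm attainment forces constant modulus\<close>

theorem theorem2:
  fixes \<phi> :: "real \<Rightarrow> complex"
  assumes "\<phi> \<in> H2"
    and "hankel_norm_attaining \<phi>"
    and "hankel_maximal_norm \<phi>"
  shows "hankel_minimal_norm \<phi>"
proof -
  obtain g where g: "g \<in> H2" and h: "in_L2 (\<lambda>t. cnj (\<phi> t) * g t)" and g1: "L2_norm g = 1"
    and att: "hankel_norm \<phi> = ereal (L2_norm (hankel \<phi> g))"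
    using assms(2) by (auto simp: hankel_norm_attaining_def hankel_dom_def)
  define m where "m = L2_norm (hankel \<phi> g)"
  have m0: "0 \<le> m" by (simp add: m_def L2_norm_def)
  \<comment> \<open>Attainment makes the operator norm a real number, so maximal norm bounds the
    symbol almost everywhere.\<close>
  have "Linf_norm \<phi> = ereal m"
    using assms(3) att by (simp add: hankel_maximal_norm_def m_def)
  then have phi_le: "AE t in T_measure. cmod (\<phi> t) \<le> m"
    using esssup_AE[where f = "\<lambda>t. ereal (cmod (\<phi> t))" and M = T_measure]
    by (simp add: Linf_norm_def)
  have gL2: "in_L2 g" using g by (rule H2_in_L2)
  have int_g: "integrable T_measure (\<lambda>t. (cmod (g t))\<^sup>2)" and g_one: "(LINT t|T_measure. (cmod (g t))\<^sup>2) = 1"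
    using gL2 g1 by (simp_all add: in_L2_def L2_norm_def)
  have int_h: "integrable T_measure (\<lambda>t. (cmod (cnj (\<phi> t) * g t))\<^sup>2)"
    using h by (simp add: in_L2_def)
  \<comment> \<open>Nonnegative almost everywhere, with integral \<open>m^2\<close> minus the
    squared norm of \<open>cnj \<phi> g\<close>; contractivity of the projection makes this at most
    0.\<close>
  let ?d = "\<lambda>t. m\<^sup>2 * (cmod (g t))\<^sup>2 - (cmod (cnj (\<phi> t) * g t))\<^sup>2"
  have int_d: "integrable T_measure ?d"
    using int_g int_h by simp
  have d_eq: "?d t = (m\<^sup>2 - (cmod (\<phi> t))\<^sup>2) * (cmod (g t))\<^sup>2" for t
    by (simp add: norm_mult power_mult_distrib algebra_simps)
  have d_nonneg: "AE t in T_measure. 0 \<le> ?d t"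
    using phi_le
  proof eventually_elim
    case (elim t)
    then have "(cmod (\<phi> t))\<^sup>2 \<le> m\<^sup>2"
      by (intro power_mono) auto
    then show ?case
      unfolding d_eq by (intro mult_nonneg_nonneg) auto
  qed
  have "m \<le> L2_norm (\<lambda>t. cnj (\<phi> t) * g t)"
    unfolding m_def hankel_def using h by (rule L2_norm_conjP_le)
  then have "m\<^sup>2 \<le> (L2_norm (\<lambda>t. cnj (\<phi> t) * g t))\<^sup>2"
    using m0 by (rule power_mono)
  also have "\<dots> = (LINT t|T_measure. (cmod (cnj (\<phi> t) * g t))\<^sup>2)"
    unfolding L2_norm_def by (rule real_sqrt_pow2) simp
  finally have "m\<^sup>2 \<le> (LINT t|T_measure. (cmod (cnj (\<phi> t) * g t))\<^sup>2)" .
  then have "(LINT t|T_measure. ?d t) \<le> 0"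
    using int_g int_h g_one by simp
  moreover have "0 \<le> (LINT t|T_measure. ?d t)"
    using d_nonneg by (rule integral_nonneg_AE)
  ultimately have "AE t in T_measure. ?d t = 0"
    using integral_nonneg_eq_0_iff_AE[OF int_d d_nonneg] by linarith
  \<comment> \<open>Allows the factor \<open>(cmod (g t))^2\<close> to be cancelled from
    \<open>?d t = 0\<close>.\<close>
  moreover have "AE t in T_measure. g t \<noteq> 0"
  proof (rule analytic_type_nonzero_AE)
    show "analytic_type g"
      using g in_L2_integrable[OF gL2] by (simp add: analytic_type_def H2_def)
    show "\<not> (AE t in T_measure. g t = 0)"
    proof
      assume "AE t in T_measure. g t = 0"
      then have "(LINT t|T_measure. (cmod (g t))\<^sup>2) = 0"
        by (intro integral_eq_zero_AE) (auto elim: eventually_mono)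
      with g_one show False by simp
    qed
  qed
  ultimately have "AE t in T_measure. (cmod (\<phi> t))\<^sup>2 = m\<^sup>2"
    by eventually_elim (simp add: d_eq del: power2_eq_iff_nonneg)
  then have "(LINT t|T_measure. (cmod (\<phi> t))\<^sup>2) = (LINT t|T_measure. m\<^sup>2)"
    using in_L2_measurable[OF H2_in_L2[OF assms(1)]] by (intro integral_cong_AE) auto
  then have "L2_norm \<phi> = m"
    using m0 by (simp add: L2_norm_def)
  then show ?thesis
    using att by (simp add: hankel_minimal_norm_def m_def)
qed

end
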